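(* For every $\eta>0$ there is $b_0$ such that for every integer constant $b\ge b_0$ there is a constant $C$ for which the following holds for every $k\ge 2$. If $k$ stations execute the protocol SublinearDecrease$(b)$ and are activated by any adaptive adversary, then, even in the case where acknowledgements are not allowed (so that stations never switch off after a successful transmission), with probability at least $1-1/k^{\eta}$ every station transmits successfully within $C k\ln^2 k$ rounds after its own activation.
   Context: Model. $k$ anonymous identical stations share a channel. Time is divided into discrete synchronous rounds; there is no global clock available to the stations and no collision detection. Initially all stations are asleep. Each station holds one packet and is activated once, at a time chosen by an adversary. The activation round is round $0$ of the station's local clock, and the station may transmit from its local round $1$ on. In each round every active station either transmits or listens. A transmission is successful if and only if exactly one active station transmits in that round. The stations do not know $k$. Here acknowledgements are not available: a station gets no feedback on its transmissions and continues the protocol after a successful transmission. An adaptive adversary decides online which station to activate and when, knowing the algorithm's code and the history of the computation but not future randomness; in total it activates $k$ stations. Protocol SublinearDecrease$(b)$ (executed by each station from its activation): for $j=3,4,5,\ldots$: for $b$ rounds, transmit in each round with probability $\frac{\ln j}{j}$, independently over rounds and stations. *)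

theory Defs
  imports "HOL-Probability.Probability"
begin

text \<open>
  Stations are the numbers below \<open>k\<close>. A history lists the rounds played so far; each entry
  consists of the set of stations activated in that round and the set of stations that
  transmitted in it.
\<close>

type_synonym history = "(nat set \<times> nat set) list"

text \<open>
  An adaptive adversary maps the history of all earlier rounds to the stations it wants to
  activate in the current round.
\<close>

type_synonym adversary = "history \<Rightarrow> nat set"

text \<open>Phase \<open>j = 3, 4, \<dots>\<close> occupies the \<open>b\<close> local rounds \<open>(j - 3) * b + 1, \<dots>, (j - 2) * b\<close>.\<close>

definition phase :: "nat \<Rightarrow> nat \<Rightarrow> nat" where
  "phase b i = 3 + (i - 1) div b"

definition transmission_prob :: "nat \<Rightarrow> nat \<Rightarrow> real" where
  "transmission_prob b i = ln (real (phase b i)) / real (phase b i)"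

text \<open>
  Coordinate \<open>(v, i)\<close> is the random choice of station \<open>v\<close> in its local round \<open>i\<close>; only
  \<open>v < k\<close> and \<open>i \<ge> 1\<close> are ever used.
\<close>

definition coin_space :: "nat \<Rightarrow> (nat \<times> nat \<Rightarrow> bool) measure" where
  "coin_space b = (\<Pi>\<^sub>M vi\<in>UNIV. measure_pmf (bernoulli_pmf (transmission_prob b (snd vi))))"

definition activated_before :: "history \<Rightarrow> nat set" where
  "activated_before h = {v. \<exists>s<length h. v \<in> fst (h ! s)}"

text \<open>
  The round following history \<open>h\<close> has global number \<open>length h\<close>. Requests to activate a
  nonexistent or already activated station are void, so that every station is activated at
  most once. A station activated in round \<open>s\<close> is in its local round \<open>length h - s\<close>; it never
  switches off, whatever the outcome of its transmissions.
\<close>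

definition next_round ::
  "nat \<Rightarrow> adversary \<Rightarrow> (nat \<times> nat \<Rightarrow> bool) \<Rightarrow> history \<Rightarrow> nat set \<times> nat set" where
  "next_round k adv \<omega> h =
     ((adv h \<inter> {..<k}) - activated_before h,
      {v. \<exists>s<length h. v \<in> fst (h ! s) \<and> \<omega> (v, length h - s)})"

primrec run :: "nat \<Rightarrow> adversary \<Rightarrow> (nat \<times> nat \<Rightarrow> bool) \<Rightarrow> nat \<Rightarrow> history" where
  "run k adv \<omega> 0 = []"
| "run k adv \<omega> (Suc t) = run k adv \<omega> t @ [next_round k adv \<omega> (run k adv \<omega> t)]"

definition activated_at ::
  "nat \<Rightarrow> adversary \<Rightarrow> (nat \<times> nat \<Rightarrow> bool) \<Rightarrow> nat \<Rightarrow> nat set" where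
  "activated_at k adv \<omega> t = fst (next_round k adv \<omega> (run k adv \<omega> t))"

definition transmitters ::
  "nat \<Rightarrow> adversary \<Rightarrow> (nat \<times> nat \<Rightarrow> bool) \<Rightarrow> nat \<Rightarrow> nat set" where
  "transmitters k adv \<omega> t = snd (next_round k adv \<omega> (run k adv \<omega> t))"

definition successful ::
  "nat \<Rightarrow> adversary \<Rightarrow> (nat \<times> nat \<Rightarrow> bool) \<Rightarrow> nat \<Rightarrow> nat \<Rightarrow> bool" where
  "successful k adv \<omega> v t \<longleftrightarrow> transmitters k adv \<omega> t = {v}"

definition succeeds_within ::
  "nat \<Rightarrow> adversary \<Rightarrow> (nat \<times> nat \<Rightarrow> bool) \<Rightarrow> real \<Rightarrow> nat \<Rightarrow> bool" where
  "succeeds_within k adv \<omega> L v \<longleftrightarrow>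
     (\<exists>s t. v \<in> activated_at k adv \<omega> s \<and> s < t \<and> real t \<le> real s + L \<and>
            successful k adv \<omega> v t)"

text \<open>
  The adversary activates all \<open>k\<close> stations. This is required almost surely only, since an
  adaptive adversary may wait for an event, such as a first successful transmission, that
  occurs merely with probability 1.
\<close>

definition activates_all :: "nat \<Rightarrow> nat \<Rightarrow> adversary \<Rightarrow> bool" where
  "activates_all b k adv \<longleftrightarrow>
     (AE \<omega> in coin_space b. \<forall>v<k. \<exists>t. v \<in> activated_at k adv \<omega> t)"

end

theory Submission
  imports Defs "HOL-Real_Asymp.Real_Asymp"
begin

text \<open>
  Let \<open>v\<close> be activated in round \<open>s\<close> and let \<open>T\<close> be of order \<open>k ln\<^sup>2 k\<close>. Since the transmission
  probabilities decrease, the loads (sums of transmission probabilities) of the rounds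
  \<open>s + 1, \<dots>, s + T\<close> add up to at most \<open>k\<close> times the sum of the first \<open>T\<close> transmission probabilities,
  that is, to \<open>O(k b ln\<^sup>2 T)\<close>, whatever the adversary does. If the constant in \<open>T\<close> is large, at
  least half of these rounds therefore have load at most \<open>1/2\<close>. Given the history, \<open>v\<close> transmits
  alone in such a round with probability at least \<open>q = p(T) / 2\<close>, where \<open>p(T)\<close> is the transmission
  probability in local round \<open>T\<close>. An exponential supermartingale turns this into the failure
  probability \<open>exp (- q T / 2)\<close>, which is at most \<open>k powr (- b / 8)\<close>; a union bound over the
  stations concludes.
\<close>

section \<open>Independent coins\<close>

lemma phase_ge_3: "phase b i \<ge> 3"
  by (simp add: phase_def)

lemma transmission_prob_nonneg: "transmission_prob b i \<ge> 0"
  using phase_ge_3[of b i] by (simp add: transmission_prob_def)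

lemma transmission_prob_le_1: "transmission_prob b i \<le> 1"
proof -
  have "ln (real (phase b i)) \<le> real (phase b i)"
    using phase_ge_3[of b i] ln_le_minus_one[of "real (phase b i)"] by simp
  thus ?thesis using phase_ge_3[of b i] by (simp add: transmission_prob_def)
qed

text \<open>The function \<open>ln x / x\<close> decreases only from \<open>exp 1\<close> on; the
  phases start at 3, which lies just above.\<close>

lemma transmission_prob_antimono:
  assumes "i \<le> j"
  shows "transmission_prob b j \<le> transmission_prob b i"
  unfolding transmission_prob_def
proof (rule ln_x_over_x_mono)
  show "exp 1 \<le> real (phase b i)"
    using exp_le phase_ge_3[of b i] by linarith
  show "real (phase b i) \<le> real (phase b j)"
    using assms by (auto simp: phase_def intro!: div_le_mono diff_le_mono)
qed

lemma prob_space_coin_space: "prob_space (coin_space b)"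
  unfolding coin_space_def by (intro prob_space_PiM measure_pmf.prob_space_axioms)

lemma space_coin_space [simp]: "space (coin_space b) = UNIV"
  by (simp add: coin_space_def space_PiM PiE_UNIV_domain)

text \<open>Membership in \<open>E\<close> depends only on the coordinates in \<open>A\<close>; one
  implication suffices because \<open>\<omega>\<close> and \<open>\<omega>'\<close> can be swapped.
  For finite \<open>A\<close> this yields measurability, and for disjoint coordinate sets
  independence.\<close>

definition determined_by :: "('a \<Rightarrow> 'b) set \<Rightarrow> 'a set \<Rightarrow> bool" where
  "determined_by E A \<longleftrightarrow> (\<forall>\<omega> \<omega>'. (\<forall>x\<in>A. \<omega> x = \<omega>' x) \<longrightarrow> \<omega> \<in> E \<longrightarrow> \<omega>' \<in> E)"

lemma determined_by_preimage:
  assumes "determined_by E A"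
  shows "E = (\<lambda>\<omega>. restrict \<omega> A) -` ((\<lambda>\<omega>. restrict \<omega> A) ` E)"
proof -
  have "\<omega> \<in> E" if "restrict \<omega> A = restrict \<omega>' A" "\<omega>' \<in> E" for \<omega> \<omega>'
    using assms that unfolding determined_by_def restrict_def by metis
  thus ?thesis by auto
qed

text \<open>Independence means that the joint distribution is the product of the marginals. Here the
  joint map is the identity on the product space, and the marginals are its factors.\<close>

lemma indep_vars_coins:
  "prob_space.indep_vars (coin_space b) (\<lambda>_. count_space UNIV) (\<lambda>x \<omega>. \<omega> x) UNIV"
proof -
  interpret prob_space "coin_space b" by (rule prob_space_coin_space)
  let ?M = "\<lambda>x::nat \<times> nat. measure_pmf (bernoulli_pmf (transmission_prob b (snd x)))"
  interpret P: product_prob_space ?M UNIV ..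
  have m: "(\<lambda>\<omega>. \<omega> x) \<in> measurable (coin_space b) (count_space UNIV)" for x
    unfolding coin_space_def by measurable
  have s: "sets (PiM UNIV (\<lambda>_. count_space UNIV)) = sets (coin_space b)"
    unfolding coin_space_def by (intro sets_PiM_cong) auto
  have d: "distr (coin_space b) (count_space UNIV) (\<lambda>\<omega>. \<omega> x) = ?M x" for x
  proof -
    have "distr (coin_space b) (count_space UNIV) (\<lambda>\<omega>. \<omega> x) = distr (PiM UNIV ?M) (?M x) (\<lambda>\<omega>. \<omega> x)"
      unfolding coin_space_def by (intro distr_cong) auto
    also have "\<dots> = ?M x" by (rule P.PiM_component) simp
    finally show ?thesis .
  qed
  show ?thesis
    using m s by (subst indep_vars_iff_distr_eq_PiM)
      (auto simp: d restrict_UNIV distr_id2 coin_space_def[symmetric])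
qed

lemma sets_determined_by:
  assumes "determined_by E A" "finite A"
  shows "E \<in> sets (coin_space b)"
proof -
  have "(\<lambda>\<omega>. restrict \<omega> A) \<in> measurable (coin_space b) (PiM A (\<lambda>_. count_space UNIV))"
    unfolding coin_space_def by measurable
  \<comment> \<open>A finite product of discrete spaces over \<open>bool\<close> is again discrete,
    so any image is measurable in it.\<close>
  moreover have "(\<lambda>\<omega>. restrict \<omega> A) ` E \<in> sets (PiM A (\<lambda>_. count_space (UNIV :: bool set)))"
    using assms(2) by (subst count_space_PiM_finite) auto
  ultimately have "(\<lambda>\<omega>. restrict \<omega> A) -` ((\<lambda>\<omega>. restrict \<omega> A) ` E) \<inter> space (coin_space b) \<in> sets (coin_space b)"
    by (rule measurable_sets)
  thus ?thesis using determined_by_preimage[OF assms(1)] by simp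
qed

lemma prob_Int_determined_by:
  assumes E: "determined_by E A" "finite A" and F: "determined_by F B" "finite B"
    and "A \<inter> B = {}"
  shows "measure (coin_space b) (E \<inter> F) = measure (coin_space b) E * measure (coin_space b) F"
proof -
  interpret prob_space "coin_space b" by (rule prob_space_coin_space)
  let ?r = "\<lambda>A \<omega>. restrict \<omega> A :: nat \<times> nat \<Rightarrow> bool"
  have sets: "?r A ` E \<in> sets (PiM A (\<lambda>_. count_space (UNIV :: bool set)))" if "finite A" for A E
    using that by (subst count_space_PiM_finite) auto
  have "indep_var (PiM A (\<lambda>_. count_space UNIV)) (?r A) (PiM B (\<lambda>_. count_space UNIV)) (?r B)"
    using indep_var_restrict[OF indep_vars_coins assms(5)] by simp
  from indep_varD[OF this sets[OF E(2)] sets[OF F(2)], of E F]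
  have "prob ((?r A -` ?r A ` E) \<inter> (?r B -` ?r B ` F))
      = prob (?r A -` ?r A ` E) * prob (?r B -` ?r B ` F)"
    by (simp add: vimage_def Int_def)
  thus ?thesis
    using determined_by_preimage[OF E(1)] determined_by_preimage[OF F(1)] by simp
qed

lemma prob_cylinder:
  assumes "finite A"
  shows "measure (coin_space b) {\<omega>. \<forall>x\<in>A. \<omega> x = c x} =
    (\<Prod>x\<in>A. if c x then transmission_prob b (snd x) else 1 - transmission_prob b (snd x))"
proof -
  let ?M = "\<lambda>x::nat \<times> nat. measure_pmf (bernoulli_pmf (transmission_prob b (snd x)))"
  interpret P: product_prob_space ?M UNIV ..
  have "emeasure (PiM UNIV ?M) {\<omega>\<in>space (PiM UNIV ?M). \<forall>x\<in>A. \<omega> x \<in> {c x}}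
      = (\<Prod>x\<in>A. emeasure (?M x) {c x})"
    using assms by (intro P.emeasure_PiM_Collect) auto
  also have "\<dots> = ennreal (\<Prod>x\<in>A. pmf (bernoulli_pmf (transmission_prob b (snd x))) (c x))"
    by (simp add: emeasure_pmf_single prod_ennreal)
  also have "(\<Prod>x\<in>A. pmf (bernoulli_pmf (transmission_prob b (snd x))) (c x)) =
     (\<Prod>x\<in>A. if c x then transmission_prob b (snd x) else 1 - transmission_prob b (snd x))"
  proof (intro prod.cong refl)
    fix x
    show "pmf (bernoulli_pmf (transmission_prob b (snd x))) (c x) =
      (if c x then transmission_prob b (snd x) else 1 - transmission_prob b (snd x))"
      by (cases "c x") (simp_all add: transmission_prob_nonneg transmission_prob_le_1)
  qed
  finally have "emeasure (coin_space b) {\<omega>. \<forall>x\<in>A. \<omega> x = c x} = ennreal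
     (\<Prod>x\<in>A. if c x then transmission_prob b (snd x) else 1 - transmission_prob b (snd x))"
    by (simp add: coin_space_def[symmetric])
  thus ?thesis
    by (simp add: measure_def prod_nonneg transmission_prob_nonneg transmission_prob_le_1)
qed

section \<open>Histories\<close>

lemma length_run [simp]: "length (run k adv \<omega> t) = t"
  by (induction t) auto

lemma take_run: "s \<le> t \<Longrightarrow> take s (run k adv \<omega> t) = run k adv \<omega> s"
proof (induction t)
  case (Suc t)
  thus ?case by (cases "s = Suc t") auto
qed simp

lemma nth_run:
  assumes "s < t"
  shows "run k adv \<omega> t ! s = next_round k adv \<omega> (run k adv \<omega> s)"
proof -
  have "run k adv \<omega> t ! s = take (Suc s) (run k adv \<omega> t) ! s"
    by simp
  also have "\<dots> = run k adv \<omega> (Suc s) ! s"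
    using assms by (subst take_run) auto
  also have "\<dots> = next_round k adv \<omega> (run k adv \<omega> s)"
    by (simp add: nth_append)
  finally show ?thesis .
qed

lemma fst_nth_run: "s < t \<Longrightarrow> fst (run k adv \<omega> t ! s) = activated_at k adv \<omega> s"
  by (simp add: nth_run activated_at_def)

lemma snd_nth_run: "s < t \<Longrightarrow> snd (run k adv \<omega> t ! s) = transmitters k adv \<omega> s"
  by (simp add: nth_run transmitters_def)

text \<open>Replaces the recursion by one condition per round of a fixed list. The adversary is then
  queried only on prefixes of \<open>h\<close>, so its answers no longer depend on the
  coins.\<close>

lemma run_eq_iff:
  "run k adv \<omega> t = h \<longleftrightarrow> length h = t \<and> (\<forall>r<t. h ! r = next_round k adv \<omega> (take r h))"
proof safe
  assume h: "\<forall>r<length h. h ! r = next_round k adv \<omega> (take r h)"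
  have "run k adv \<omega> s = take s h" if "s \<le> length h" for s
    using that by (induction s) (use h in \<open>auto simp: take_Suc_conv_app_nth\<close>)
  thus "run k adv \<omega> (length h) = h" by simp
qed (auto simp: nth_run take_run)

text \<open>The coins read by the round that follows \<open>h\<close>, and those read while \<open>h\<close> was played.\<close>

definition live :: "history \<Rightarrow> (nat \<times> nat) set" where
  "live h = (\<lambda>(s, v). (v, length h - s)) ` (SIGMA s:{..<length h}. fst (h ! s))"

definition past :: "history \<Rightarrow> (nat \<times> nat) set" where
  "past h = (\<Union>r<length h. live (take r h))"

lemma in_live_iff:
  "(v, i) \<in> live h \<longleftrightarrow> (\<exists>s<length h. v \<in> fst (h ! s) \<and> i = length h - s)"
  unfolding live_def by (auto simp: image_iff)

lemma snd_next_round: "snd (next_round k adv \<omega> h) = {v. \<exists>i. (v, i) \<in> live h \<and> \<omega> (v, i)}"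
  by (auto simp: next_round_def in_live_iff)

lemma snd_next_round_cong:
  assumes "\<And>x. x \<in> live h \<Longrightarrow> \<omega> x = \<omega>' x"
  shows "snd (next_round k adv \<omega> h) = snd (next_round k adv \<omega>' h)"
  unfolding snd_next_round using assms by metis

lemma determined_by_next_round:
  "determined_by {\<omega>. P (snd (next_round k adv \<omega> h))} (live h)"
  unfolding determined_by_def using snd_next_round_cong[of h] by (metis mem_Collect_eq)

text \<open>With \<open>h\<close> fixed, the activations are functions of its prefixes; only the
  sets of transmitters read coins, and those coins lie in \<open>past h\<close>.\<close>

lemma determined_by_run: "determined_by {\<omega>. run k adv \<omega> t = h} (past h)"
  unfolding determined_by_def
proof (intro allI impI)
  fix \<omega> \<omega>' assume eq: "\<forall>x\<in>past h. \<omega> x = \<omega>' x" and "\<omega> \<in> {\<omega>. run k adv \<omega> t = h}"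
  hence t: "length h = t" and h: "\<And>r. r < t \<Longrightarrow> h ! r = next_round k adv \<omega> (take r h)"
    by (auto simp: run_eq_iff)
  have "next_round k adv \<omega> (take r h) = next_round k adv \<omega>' (take r h)" if "r < t" for r
  proof (rule prod_eqI)
    show "snd (next_round k adv \<omega> (take r h)) = snd (next_round k adv \<omega>' (take r h))"
      by (rule snd_next_round_cong) (use eq that t in \<open>auto simp: past_def\<close>)
  qed (simp add: next_round_def)
  with t h show "\<omega>' \<in> {\<omega>. run k adv \<omega> t = h}"
    by (auto simp: run_eq_iff)
qed

text \<open>A finite set containing every possible run of length \<open>t\<close>, whatever the
  adversary. The disjointness clause records that a station is activated at most once.\<close>

definition histories :: "nat \<Rightarrow> nat \<Rightarrow> history set" where
  "histories k t = {h. length h = t \<and> set h \<subseteq> Pow {..<k} \<times> Pow {..<k} \<and>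
     (\<forall>s<t. \<forall>s'<t. s \<noteq> s' \<longrightarrow> fst (h ! s) \<inter> fst (h ! s') = {})}"

lemma finite_histories: "finite (histories k t)"
proof (rule finite_subset)
  show "histories k t \<subseteq> {h. set h \<subseteq> Pow {..<k} \<times> Pow {..<k} \<and> length h = t}"
    by (auto simp: histories_def)
qed (intro finite_lists_length_eq finite_cartesian_product finite_Pow_iff[THEN iffD2] finite_lessThan)

lemma histories_fst_subset:
  assumes "h \<in> histories k t" "s < t"
  shows "fst (h ! s) \<subseteq> {..<k}"
proof -
  have "h ! s \<in> Pow {..<k} \<times> Pow {..<k}"
    using assms nth_mem[of s h] unfolding histories_def by blast
  thus ?thesis by (simp add: mem_Times_iff)
qed

lemma histories_unique:
  "h \<in> histories k t \<Longrightarrow> s < t \<Longrightarrow> s' < t \<Longrightarrow> v \<in> fst (h ! s) \<Longrightarrow> v \<in> fst (h ! s') \<Longrightarrow> s = s'"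
  unfolding histories_def by blast

lemma activated_at_subset: "activated_at k adv \<omega> s \<subseteq> {..<k}"
  by (auto simp: activated_at_def next_round_def)

lemma transmitters_subset: "transmitters k adv \<omega> s \<subseteq> {..<k}"
  using activated_at_subset by (fastforce simp: transmitters_def next_round_def fst_nth_run)

lemma activated_at_disjoint:
  assumes "s \<noteq> s'"
  shows "activated_at k adv \<omega> s \<inter> activated_at k adv \<omega> s' = {}"
proof -
  have "activated_at k adv \<omega> s \<inter> activated_at k adv \<omega> s' = {}" if "s < s'" for s s'
    using fst_nth_run[OF that] that
    by (auto simp: activated_at_def[of k adv \<omega> s'] next_round_def activated_before_def)
  from this[of s s'] this[of s' s] show ?thesis using assms by fastforce
qed

lemma run_in_histories: "run k adv \<omega> t \<in> histories k t"
proof -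
  have "run k adv \<omega> t ! s \<in> Pow {..<k} \<times> Pow {..<k}" if "s < t" for s
    using that activated_at_subset[of k adv \<omega> s] transmitters_subset[of k adv \<omega> s]
    by (simp add: mem_Times_iff fst_nth_run snd_nth_run)
  hence "set (run k adv \<omega> t) \<subseteq> Pow {..<k} \<times> Pow {..<k}"
    unfolding set_conv_nth by fastforce
  thus ?thesis
    by (simp add: histories_def fst_nth_run activated_at_disjoint)
qed

lemma finite_live:
  assumes "h \<in> histories k t"
  shows "finite (live h)"
proof -
  have "fst (h ! s) \<subseteq> {..<k}" if "s < length h" for s
    using histories_fst_subset[OF assms] that assms by (auto simp: histories_def)
  thus ?thesis unfolding live_def
    by (intro finite_imageI finite_SigmaI finite_lessThan) (auto intro: finite_subset)
qed

lemma take_in_histories: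
  assumes "h \<in> histories k t" "r \<le> t"
  shows "take r h \<in> histories k r"
  using assms set_take_subset[of r h] by (auto simp: histories_def)

lemma finite_past: "h \<in> histories k t \<Longrightarrow> finite (past h)"
  unfolding past_def
  by (intro finite_UN_I finite_lessThan finite_live[OF take_in_histories]) (auto simp: histories_def)

text \<open>A station has a single activation round \<open>s\<close>, so the coin it reads in round
  \<open>r < t\<close> has index \<open>r - s\<close>, which differs from the index
  \<open>t - s\<close> of its live coin. Hence the next round is independent of the history.\<close>

lemma past_live_disjoint:
  assumes "h \<in> histories k t"
  shows "past h \<inter> live h = {}"
proof -
  have t: "length h = t" using assms by (simp add: histories_def)
  have False if p: "(v, i) \<in> past h" and l: "(v, i) \<in> live h" for v i
  proof -
    obtain r s where "r < t" "s < r" "v \<in> fst (h ! s)" "i = r - s"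
      using p t by (auto simp: past_def in_live_iff)
    moreover obtain s' where "s' < t" "v \<in> fst (h ! s')" "i = t - s'"
      using l t by (auto simp: in_live_iff)
    moreover from calculation have "s = s'"
      using histories_unique[OF assms, of s s' v] by simp
    ultimately show False by simp
  qed
  thus ?thesis by auto
qed

section \<open>Load of a round: the expected number of its transmitters given the history\<close>

definition load :: "nat \<Rightarrow> history \<Rightarrow> real" where
  "load b h = (\<Sum>x\<in>live h. transmission_prob b (snd x))"

lemma load_nonneg: "load b h \<ge> 0"
  by (simp add: load_def sum_nonneg transmission_prob_nonneg)

lemma load_eq:
  assumes "h \<in> histories k t"
  shows "load b h = (\<Sum>s<t. card (fst (h ! s)) * transmission_prob b (t - s))"
proof -
  have t: "length h = t" using assms by (simp add: histories_def)
  have fin: "finite (fst (h ! s))" if "s < t" for s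
    using histories_fst_subset[OF assms that] by (rule finite_subset) simp
  have "inj_on (\<lambda>(s, v). (v, length h - s)) (SIGMA s:{..<length h}. fst (h ! s))"
    by (auto simp: inj_on_def)
  hence "load b h = (\<Sum>(s, v)\<in>(SIGMA s:{..<t}. fst (h ! s)). transmission_prob b (t - s))"
    unfolding load_def live_def by (simp add: sum.reindex case_prod_unfold t)
  also have "\<dots> = (\<Sum>s<t. \<Sum>v\<in>fst (h ! s). transmission_prob b (t - s))"
    using fin by (subst sum.Sigma) auto
  finally show ?thesis by simp
qed

text \<open>The coin of \<open>v\<close> must show success and all other live coins failure. By the
  Weierstrass inequality the latter has probability at least one minus the load, hence at least
  \<open>1 / 2\<close>.\<close>

lemma prob_transmits_alone_ge:
  assumes h: "h \<in> histories k t" and x: "(v, i) \<in> live h" and "load b h \<le> 1 / 2"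
  shows "measure (coin_space b) {\<omega>. snd (next_round k adv \<omega> h) = {v}} \<ge> transmission_prob b i / 2"
proof -
  interpret prob_space "coin_space b" by (rule prob_space_coin_space)
  let ?p = "\<lambda>x. transmission_prob b (snd x)" and ?L = "live h - {(v, i)}"
  have fin: "finite (live h)" by (rule finite_live[OF h])
  have "1 - sum ?p ?L \<le> (\<Prod>x\<in>?L. 1 - ?p x)"
    by (intro Weierstrass_prod_ineq) (simp add: transmission_prob_nonneg transmission_prob_le_1)
  moreover have "sum ?p ?L \<le> load b h"
    unfolding load_def using fin by (intro sum_mono2) (auto simp: transmission_prob_nonneg)
  ultimately have "1 / 2 \<le> (\<Prod>x\<in>?L. 1 - ?p x)"
    using assms(3) by linarith
  hence "transmission_prob b i / 2 \<le> transmission_prob b i * (\<Prod>x\<in>?L. 1 - ?p x)"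
    using mult_left_mono[OF _ transmission_prob_nonneg[of b i]] by fastforce
  also have "\<dots> = (\<Prod>x\<in>live h. if x = (v, i) then ?p x else 1 - ?p x)"
    by (subst prod.remove[OF fin x]) (auto intro!: prod.cong)
  also have "\<dots> = prob {\<omega>. \<forall>x\<in>live h. \<omega> x = (x = (v, i))}"
    by (rule prob_cylinder[OF fin, symmetric])
  also have "\<dots> \<le> prob {\<omega>. snd (next_round k adv \<omega> h) = {v}}"
  proof (rule finite_measure_mono)
    show "{\<omega>. \<forall>x\<in>live h. \<omega> x = (x = (v, i))} \<subseteq> {\<omega>. snd (next_round k adv \<omega> h) = {v}}"
      using x by (auto simp: snd_next_round)
    show "{\<omega>. snd (next_round k adv \<omega> h) = {v}} \<in> events"
      using determined_by_next_round[of "\<lambda>y. y = {v}"] fin by (rule sets_determined_by)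
  qed
  finally show ?thesis .
qed

section \<open>Measurability of runs and the exponential supermartingale\<close>

lemma sets_run_eq:
  "h \<in> histories k t \<Longrightarrow> {\<omega>. run k adv \<omega> t = h} \<in> sets (coin_space b)"
  by (rule sets_determined_by[OF determined_by_run finite_past])

text \<open>The run takes finitely many values, so no regularity of the adversary or of
  \<open>P\<close> is required.\<close>

lemma sets_run: "{\<omega>. P (run k adv \<omega> t)} \<in> sets (coin_space b)"
proof -
  have "{\<omega>. P (run k adv \<omega> t)} = (\<Union>h\<in>{h\<in>histories k t. P h}. {\<omega>. run k adv \<omega> t = h})"
    using run_in_histories by auto
  also have "\<dots> \<in> sets (coin_space b)"
    using finite_histories sets_run_eq by (intro sets.finite_UN) auto
  finally show ?thesis .
qed

text \<open>The rounds in which \<open>v\<close> is guaranteed a good chance: low load, and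
  \<open>v\<close> still within its first \<open>T\<close> local rounds, so that its transmission
  probability is at least that of local round \<open>T\<close>.\<close>

definition scoring :: "nat \<Rightarrow> nat \<Rightarrow> nat \<Rightarrow> history \<Rightarrow> bool" where
  "scoring b T v h \<longleftrightarrow> load b h \<le> 1 / 2 \<and> (\<exists>i\<le>T. (v, i) \<in> live h)"

definition gain :: "nat \<Rightarrow> nat \<Rightarrow> real \<Rightarrow> nat \<Rightarrow> history \<Rightarrow> nat set \<Rightarrow> real" where
  "gain b T q v h y = (if scoring b T v h then if y = {v} then 0 else exp q else 1)"

text \<open>
  The potential vanishes once \<open>v\<close> succeeds in a scoring round and otherwise is \<open>e\<^sup>q\<close> to the number
  of scoring rounds. It is a supermartingale because \<open>e\<^sup>q (1 - p) \<le> 1\<close> for \<open>p \<ge> q\<close>.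
\<close>

definition potential :: "nat \<Rightarrow> nat \<Rightarrow> real \<Rightarrow> nat \<Rightarrow> history \<Rightarrow> real" where
  "potential b T q v h = (\<Prod>r<length h. gain b T q v (take r h) (snd (h ! r)))"

lemma potential_nonneg: "potential b T q v h \<ge> 0"
  by (auto simp: potential_def gain_def intro!: prod_nonneg)

lemma potential_snoc: "potential b T q v (h @ [x]) = potential b T q v h * gain b T q v h (snd x)"
  by (simp add: potential_def nth_append)

text \<open>Turns an expectation over runs into a finite sum over fixed histories, which replaces
  conditioning on the history.\<close>

lemma run_decomposition:
  fixes f :: "history \<Rightarrow> 'a::real_vector"
  shows "f (run k adv \<omega> t) = (\<Sum>h\<in>histories k t. indicator {\<omega>. run k adv \<omega> t = h} \<omega> *\<^sub>R f h)"
proof -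
  have "(\<Sum>h\<in>histories k t. indicator {\<omega>. run k adv \<omega> t = h} \<omega> *\<^sub>R f h)
      = (\<Sum>h\<in>histories k t. if h = run k adv \<omega> t then f h else 0)"
    by (intro sum.cong) (auto simp: indicator_def)
  thus ?thesis using finite_histories run_in_histories by simp
qed

lemma integrable_run:
  fixes f :: "history \<Rightarrow> real"
  shows "integrable (coin_space b) (\<lambda>\<omega>. f (run k adv \<omega> t))"
proof -
  interpret prob_space "coin_space b" by (rule prob_space_coin_space)
  have "integrable (coin_space b) (\<lambda>\<omega>. \<Sum>h\<in>histories k t. indicator {\<omega>. run k adv \<omega> t = h} \<omega> *\<^sub>R f h)"
    by (intro Bochner_Integration.integrable_sum integrable_scaleR_left)
      (auto simp: integrable_indicator_iff emeasure_eq_measure sets_run_eq)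
  thus ?thesis using run_decomposition[of f k adv _ t] by simp
qed

lemma expectation_potential_Suc_le:
  assumes "q \<le> transmission_prob b T / 2"
  shows "(\<integral>\<omega>. potential b T q v (run k adv \<omega> (Suc t)) \<partial>coin_space b)
      \<le> (\<integral>\<omega>. potential b T q v (run k adv \<omega> t) \<partial>coin_space b)"
proof -
  interpret prob_space "coin_space b" by (rule prob_space_coin_space)
  let ?P = "potential b T q v"
  let ?R = "\<lambda>h. {\<omega>. run k adv \<omega> t = h}"
  let ?g = "\<lambda>h \<omega>. gain b T q v h (snd (next_round k adv \<omega> h))"
  let ?S = "\<lambda>h. {\<omega>. snd (next_round k adv \<omega> h) = {v}}"
  \<comment> \<open>The supermartingale inequality for one fixed history: on the event that
    \<open>h\<close> was played, the expected gain of the next round is at most 1.\<close>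
  have *: "integrable (coin_space b) (\<lambda>\<omega>. indicator (?R h) \<omega> * ?g h \<omega>) \<and>
      (\<integral>\<omega>. indicator (?R h) \<omega> * ?g h \<omega> \<partial>coin_space b) \<le> prob (?R h)"
    if h: "h \<in> histories k t" for h
  proof (cases "scoring b T v h")
    case False
    thus ?thesis using sets_run_eq[OF h]
      by (simp add: gain_def integrable_indicator_iff emeasure_eq_measure)
  next
    case True
    then obtain i where i: "load b h \<le> 1 / 2" "i \<le> T" "(v, i) \<in> live h"
      by (auto simp: scoring_def)
    have "q \<le> transmission_prob b i / 2"
      using assms transmission_prob_antimono[OF i(2), of b] by linarith
    also have "\<dots> \<le> prob (?S h)"
      by (rule prob_transmits_alone_ge[OF h i(3,1)])
    finally have q: "q \<le> prob (?S h)" .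
    have det: "determined_by (?S h) (live h)"
      by (rule determined_by_next_round)
    have S: "?S h \<in> events"
      using det finite_live[OF h] by (rule sets_determined_by)
    have R: "?R h \<in> events" by (rule sets_run_eq[OF h])
    have "prob (?R h - ?S h) = prob (?R h) - prob (?R h \<inter> ?S h)"
      using R S by (rule finite_measure_Diff')
    \<comment> \<open>The history reads only \<open>past h\<close>, the next transmissions only
      \<open>live h\<close>.\<close>
    also have "prob (?R h \<inter> ?S h) = prob (?R h) * prob (?S h)"
      by (rule prob_Int_determined_by[OF determined_by_run finite_past[OF h] det finite_live[OF h]
            past_live_disjoint[OF h]])
    also have "prob (?R h) - prob (?R h) * prob (?S h) = prob (?R h) * (1 - prob (?S h))"
      by (simp add: algebra_simps)
    finally have "exp q * prob (?R h - ?S h) = prob (?R h) * (exp q * (1 - prob (?S h)))"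
      by simp
    also have "exp q * (1 - prob (?S h)) \<le> exp q * exp (- q)"
      using q exp_ge_add_one_self[of "- q"] by (intro mult_left_mono) auto
    finally have le: "exp q * prob (?R h - ?S h) \<le> prob (?R h)"
      by (simp add: mult_left_le exp_minus mult_left_mono)
    have eq: "indicator (?R h) \<omega> * ?g h \<omega> = exp q * indicator (?R h - ?S h) \<omega>" for \<omega>
      using True by (simp add: gain_def indicator_def)
    show ?thesis using le R S
      by (simp add: eq integrable_indicator_iff emeasure_eq_measure)
  qed
  have "(\<integral>\<omega>. ?P (run k adv \<omega> (Suc t)) \<partial>coin_space b)
      = (\<integral>\<omega>. (\<Sum>h\<in>histories k t. ?P h * (indicator (?R h) \<omega> * ?g h \<omega>)) \<partial>coin_space b)"
  proof (intro Bochner_Integration.integral_cong refl)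
    fix \<omega>
    have "?P (run k adv \<omega> (Suc t)) = (\<lambda>h. ?P h * ?g h \<omega>) (run k adv \<omega> t)"
      by (simp add: potential_snoc)
    also have "\<dots> = (\<Sum>h\<in>histories k t. ?P h * (indicator (?R h) \<omega> * ?g h \<omega>))"
      by (subst run_decomposition) (simp add: algebra_simps)
    finally show "?P (run k adv \<omega> (Suc t)) = (\<Sum>h\<in>histories k t. ?P h * (indicator (?R h) \<omega> * ?g h \<omega>))" .
  qed
  also have "\<dots> = (\<Sum>h\<in>histories k t. ?P h * (\<integral>\<omega>. indicator (?R h) \<omega> * ?g h \<omega> \<partial>coin_space b))"
    using * by (subst Bochner_Integration.integral_sum) auto
  also have "\<dots> \<le> (\<Sum>h\<in>histories k t. ?P h * prob (?R h))"
    using * potential_nonneg by (intro sum_mono mult_left_mono) auto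
  also have "\<dots> = (\<integral>\<omega>. (\<Sum>h\<in>histories k t. indicator (?R h) \<omega> *\<^sub>R ?P h) \<partial>coin_space b)"
    using sets_run_eq by (subst Bochner_Integration.integral_sum)
      (auto simp: integrable_indicator_iff emeasure_eq_measure mult.commute)
  also have "\<dots> = (\<integral>\<omega>. ?P (run k adv \<omega> t) \<partial>coin_space b)"
    by (simp only: run_decomposition[of ?P, symmetric])
  finally show ?thesis .
qed

lemma expectation_potential_le_1:
  assumes "q \<le> transmission_prob b T / 2"
  shows "(\<integral>\<omega>. potential b T q v (run k adv \<omega> t) \<partial>coin_space b) \<le> 1"
proof (induction t)
  case 0
  interpret prob_space "coin_space b" by (rule prob_space_coin_space)
  show ?case by (simp add: potential_def prob_space)
next
  case (Suc t)
  thus ?case using expectation_potential_Suc_le[OF assms] by (rule order_trans[rotated])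
qed

section \<open>Low load in a window\<close>

text \<open>A station activated at \<open>u \<le> s\<close> is in local round at least
  \<open>i\<close> in round \<open>s + i\<close>, so monotonicity gives a termwise bound. One
  activated later contributes only an initial segment of the sum on the right.\<close>

lemma window_transmission_prob_le:
  "(\<Sum>r\<in>{s<..s + T}. if u < r then transmission_prob b (r - u) else 0)
     \<le> (\<Sum>i=1..T. transmission_prob b i)"
proof -
  have "(\<Sum>r\<in>{s<..s + T}. if u < r then transmission_prob b (r - u) else 0)
      = (\<Sum>i=1..T. if u < s + i then transmission_prob b (s + i - u) else 0)"
    by (intro sum.reindex_bij_witness[of _ "\<lambda>i. s + i" "\<lambda>r. r - s"]) auto
  also have "\<dots> \<le> (\<Sum>i=1..T. transmission_prob b i)"
  proof (cases "u \<le> s")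
    case True
    thus ?thesis by (intro sum_mono) (auto intro!: transmission_prob_antimono transmission_prob_nonneg)
  next
    case False
    have "(\<Sum>i=1..T. if u < s + i then transmission_prob b (s + i - u) else 0)
        = (\<Sum>i\<in>{u - s<..T}. transmission_prob b (s + i - u))"
      using False by (intro sum.mono_neutral_cong_right) auto
    also have "\<dots> = (\<Sum>i=1..T - (u - s). transmission_prob b i)"
      using False by (intro sum.reindex_bij_witness[of _ "\<lambda>i. i + (u - s)" "\<lambda>i. s + i - u"]) auto
    also have "\<dots> \<le> (\<Sum>i=1..T. transmission_prob b i)"
      by (intro sum_mono2) (auto simp: transmission_prob_nonneg)
    finally show ?thesis .
  qed
  finally show ?thesis .
qed

lemma sum_card_activated_at_le: "(\<Sum>s<t. card (activated_at k adv \<omega> s)) \<le> k"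
proof -
  have "(\<Sum>s<t. card (activated_at k adv \<omega> s)) = card (\<Union>s<t. activated_at k adv \<omega> s)"
    using activated_at_disjoint finite_subset[OF activated_at_subset finite_lessThan]
    by (subst card_UN_disjoint) auto
  also have "\<dots> \<le> card {..<k}"
    using activated_at_subset by (intro card_mono UN_least) auto
  finally show ?thesis by simp
qed

text \<open>Exchange of summation: the load is charged to the activation rounds, each station pays
  at most the sum of the first \<open>T\<close> probabilities, and there are at most
  \<open>k\<close> stations.\<close>

lemma window_load_le:
  "(\<Sum>r\<in>{s<..s + T}. load b (run k adv \<omega> r)) \<le> k * (\<Sum>i=1..T. transmission_prob b i)"
proof -
  let ?c = "\<lambda>u. real (card (activated_at k adv \<omega> u))"
  let ?p = "\<lambda>u r. if u < r then transmission_prob b (r - u) else 0"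
  have "load b (run k adv \<omega> r) = (\<Sum>u<s + T. ?c u * ?p u r)" if "r \<le> s + T" for r
  proof -
    have "load b (run k adv \<omega> r) = (\<Sum>u<r. ?c u * transmission_prob b (r - u))"
      by (subst load_eq[OF run_in_histories]) (simp add: fst_nth_run)
    also have "\<dots> = (\<Sum>u<s + T. ?c u * ?p u r)"
      using that by (intro sum.mono_neutral_cong_left) auto
    finally show ?thesis .
  qed
  hence "(\<Sum>r\<in>{s<..s + T}. load b (run k adv \<omega> r)) = (\<Sum>r\<in>{s<..s + T}. \<Sum>u<s + T. ?c u * ?p u r)"
    by (intro sum.cong) auto
  also have "\<dots> = (\<Sum>u<s + T. ?c u * (\<Sum>r\<in>{s<..s + T}. ?p u r))"
    by (subst sum.swap) (simp add: sum_distrib_left)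
  also have "\<dots> \<le> (\<Sum>u<s + T. ?c u * (\<Sum>i=1..T. transmission_prob b i))"
    by (intro sum_mono mult_left_mono window_transmission_prob_le) auto
  also have "\<dots> = real (\<Sum>u<s + T. card (activated_at k adv \<omega> u)) * (\<Sum>i=1..T. transmission_prob b i)"
    by (simp add: sum_distrib_right)
  also have "\<dots> \<le> k * (\<Sum>i=1..T. transmission_prob b i)"
    by (intro mult_right_mono of_nat_mono sum_card_activated_at_le sum_nonneg transmission_prob_nonneg)
  finally show ?thesis .
qed

text \<open>Markov counting: the total load of the window is at most \<open>T / 4\<close>, while
  each excluded round carries more than \<open>1 / 2\<close>, so at most \<open>T / 2\<close> rounds
  are excluded.\<close>

lemma card_low_load_ge:
  assumes "4 * real k * (\<Sum>i=1..T. transmission_prob b i) \<le> T"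
  shows "real T / 2 \<le> card {r\<in>{s<..s + T}. load b (run k adv \<omega> r) \<le> 1 / 2}" (is "_ \<le> real (card ?W)")
proof -
  let ?I = "{s<..s + T}"
  have "real (card (?I - ?W)) * (1 / 2) = (\<Sum>r\<in>?I - ?W. 1 / 2)"
    by simp
  also have "\<dots> \<le> (\<Sum>r\<in>?I - ?W. load b (run k adv \<omega> r))"
    by (intro sum_mono) auto
  also have "\<dots> \<le> (\<Sum>r\<in>?I. load b (run k adv \<omega> r))"
    by (intro sum_mono2) (auto simp: load_nonneg)
  also have "\<dots> \<le> real k * (\<Sum>i=1..T. transmission_prob b i)"
    by (rule window_load_le)
  finally have "real (card (?I - ?W)) \<le> T / 2"
    using assms by simp
  moreover have "card (?I - ?W) = T - card ?W"
    by (subst card_Diff_subset) auto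
  moreover have "card ?W \<le> card ?I"
    by (intro card_mono) auto
  ultimately show ?thesis by (simp add: of_nat_diff)
qed

section \<open>Probability that a station fails throughout its window, and the union bound\<close>

definition fails_before :: "nat \<Rightarrow> adversary \<Rightarrow> nat \<Rightarrow> nat \<Rightarrow> (nat \<times> nat \<Rightarrow> bool) \<Rightarrow> nat \<Rightarrow> bool" where
  "fails_before k adv T v \<omega> t \<longleftrightarrow> (\<exists>s. s + T < t \<and> v \<in> activated_at k adv \<omega> s \<and>
     (\<forall>r\<in>{s<..s + T}. \<not> successful k adv \<omega> v r))"

text \<open>Without a success in the window no factor vanishes, and each of the at least
  \<open>T / 2\<close> rounds of low load contributes \<open>exp q\<close>.\<close>

lemma potential_run_ge:
  assumes "fails_before k adv T v \<omega> t" "q \<ge> 0"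
    and "4 * real k * (\<Sum>i=1..T. transmission_prob b i) \<le> T"
  shows "exp (q * T / 2) \<le> potential b T q v (run k adv \<omega> t)"
proof -
  obtain s where s: "s + T < t" "v \<in> activated_at k adv \<omega> s"
      "\<And>r. r \<in> {s<..s + T} \<Longrightarrow> transmitters k adv \<omega> r \<noteq> {v}"
    using assms(1) by (auto simp: fails_before_def successful_def)
  let ?W = "{r\<in>{s<..s + T}. load b (run k adv \<omega> r) \<le> 1 / 2}"
  let ?g = "\<lambda>r. gain b T q v (run k adv \<omega> r) (transmitters k adv \<omega> r)"
  have W: "?g r = exp q" if "r \<in> ?W" for r
  proof -
    have "(v, r - s) \<in> live (run k adv \<omega> r)"
      unfolding in_live_iff by (rule exI[of _ s]) (use that s(2) in \<open>auto simp: fst_nth_run\<close>)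
    hence "scoring b T v (run k adv \<omega> r)"
      unfolding scoring_def using that by (auto intro!: exI[of _ "r - s"])
    thus ?thesis using s(3)[of r] that by (simp add: gain_def)
  qed
  \<comment> \<open>Since \<open>v\<close> is activated only in round \<open>s\<close>, every
    scoring round lies in the window; hence the rounds outside \<open>?W\<close> contribute the
    factor 1.\<close>
  have ge_1: "1 \<le> ?g r" if "r < t" for r
  proof (cases "scoring b T v (run k adv \<omega> r)")
    case True
    then obtain u where u: "u < r" "v \<in> activated_at k adv \<omega> u" "r - u \<le> T"
      by (auto simp: scoring_def in_live_iff fst_nth_run)
    have "u = s"
      using activated_at_disjoint[of u s k adv \<omega>] u(2) s(2) by auto
    hence "r \<in> ?W" using True u by (auto simp: scoring_def)
    thus ?thesis using W assms(2) by simp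
  qed (simp add: gain_def)
  have "q * (T / 2) \<le> q * card ?W"
    by (intro mult_left_mono card_low_load_ge assms)
  hence "exp (q * T / 2) \<le> exp q ^ card ?W"
    by (simp add: exp_of_nat_mult[symmetric] mult.commute)
  also have "\<dots> = (\<Prod>r\<in>?W. ?g r)"
    using W by simp
  also have "\<dots> \<le> (\<Prod>r<t. ?g r)"
    using s(1) ge_1 W by (intro prod_mono2) auto
  also have "\<dots> = potential b T q v (run k adv \<omega> t)"
    unfolding potential_def by (auto simp: take_run snd_nth_run intro!: prod.cong)
  finally show ?thesis .
qed

lemma sets_activated_at: "{\<omega>. v \<in> activated_at k adv \<omega> s} \<in> sets (coin_space b)"
  using sets_run[of "\<lambda>h. v \<in> fst (h ! s)" k adv "Suc s" b] by (simp only: fst_nth_run lessI)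

lemma sets_successful: "{\<omega>. successful k adv \<omega> v s} \<in> sets (coin_space b)"
  using sets_run[of "\<lambda>h. snd (h ! s) = {v}" k adv "Suc s" b]
  by (simp only: snd_nth_run lessI successful_def)

lemma sets_fails_before: "{\<omega>. fails_before k adv T v \<omega> t} \<in> sets (coin_space b)"
proof -
  have [measurable]: "Measurable.pred (coin_space b) (\<lambda>\<omega>. v \<in> activated_at k adv \<omega> s)"
    "Measurable.pred (coin_space b) (\<lambda>\<omega>. successful k adv \<omega> v s)" for s
    using sets_activated_at[of v k adv s b] sets_successful[of k adv v s b]
    by (simp_all add: Measurable.pred_def)
  have "Measurable.pred (coin_space b) (\<lambda>\<omega>. fails_before k adv T v \<omega> t)"
    unfolding fails_before_def by measurable
  thus ?thesis by (simp add: Measurable.pred_def)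
qed

lemma sets_succeeds_within: "{\<omega>. succeeds_within k adv \<omega> L v} \<in> sets (coin_space b)"
proof -
  have [measurable]: "Measurable.pred (coin_space b) (\<lambda>\<omega>. v \<in> activated_at k adv \<omega> s)"
    "Measurable.pred (coin_space b) (\<lambda>\<omega>. successful k adv \<omega> v s)" for s
    using sets_activated_at[of v k adv s b] sets_successful[of k adv v s b]
    by (simp_all add: Measurable.pred_def)
  have "Measurable.pred (coin_space b) (\<lambda>\<omega>. succeeds_within k adv \<omega> L v)"
    unfolding succeeds_within_def by measurable
  thus ?thesis by (simp add: Measurable.pred_def)
qed

lemma prob_fails_before_le:
  assumes "4 * real k * (\<Sum>i=1..T. transmission_prob b i) \<le> T"
  shows "measure (coin_space b) {\<omega>. fails_before k adv T v \<omega> t} \<le> exp (- transmission_prob b T * T / 4)"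
proof -
  interpret prob_space "coin_space b" by (rule prob_space_coin_space)
  define q where "q = transmission_prob b T / 2"
  have q: "q \<ge> 0" by (simp add: q_def transmission_prob_nonneg)
  let ?c = "exp (q * T / 2)" and ?u = "\<lambda>\<omega>. potential b T q v (run k adv \<omega> t)"
  have "prob {\<omega>. fails_before k adv T v \<omega> t} \<le> prob {\<omega>\<in>space (coin_space b). ?u \<omega> \<ge> ?c}"
    using potential_run_ge[OF _ q assms] sets_run[of "\<lambda>h. potential b T q v h \<ge> ?c" k adv t b]
    by (intro finite_measure_mono) auto
  also have "\<dots> \<le> (\<integral>\<omega>. ?u \<omega> \<partial>coin_space b) / ?c"
    by (rule integral_Markov_inequality_measure[where A = "{}"])
      (auto simp: integrable_run potential_nonneg)
  also have "\<dots> \<le> 1 / ?c"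
    by (intro divide_right_mono expectation_potential_le_1) (auto simp: q_def)
  also have "\<dots> = exp (- transmission_prob b T * T / 4)"
    by (simp add: q_def exp_minus field_simps)
  finally show ?thesis .
qed

text \<open>The horizon \<open>t\<close> made failure a property of a finite run. As the bound is
  the same for all \<open>t\<close>, continuity from below removes the horizon.\<close>

lemma prob_fails_le:
  assumes "4 * real k * (\<Sum>i=1..T. transmission_prob b i) \<le> T"
  shows "measure (coin_space b) (\<Union>t. {\<omega>. fails_before k adv T v \<omega> t})
    \<le> exp (- transmission_prob b T * T / 4)"
proof -
  interpret prob_space "coin_space b" by (rule prob_space_coin_space)
  have "incseq (\<lambda>t. {\<omega>. fails_before k adv T v \<omega> t})"
    by (auto simp: incseq_def fails_before_def intro: less_le_trans)
  hence "(\<lambda>t. prob {\<omega>. fails_before k adv T v \<omega> t}) \<longlonglongrightarrow> prob (\<Union>t. {\<omega>. fails_before k adv T v \<omega> t})"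
    using sets_fails_before by (intro finite_Lim_measure_incseq) auto
  thus ?thesis
    by (rule LIMSEQ_le_const2) (use prob_fails_before_le[OF assms] in auto)
qed

lemma prob_all_succeed_ge:
  assumes "activates_all b k adv" "real T \<le> L"
    and "4 * real k * (\<Sum>i=1..T. transmission_prob b i) \<le> T"
  shows "measure (coin_space b) {\<omega>. \<forall>v<k. succeeds_within k adv \<omega> L v}
    \<ge> 1 - k * exp (- transmission_prob b T * T / 4)"
proof -
  interpret prob_space "coin_space b" by (rule prob_space_coin_space)
  let ?S = "{\<omega>. \<forall>v<k. succeeds_within k adv \<omega> L v}"
  let ?F = "\<lambda>v. \<Union>t. {\<omega>. fails_before k adv T v \<omega> t}"
  have F: "?F v \<in> events" for v
    using sets_fails_before by (intro sets.countable_UN) auto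
  have "{\<omega>\<in>space (coin_space b). \<forall>v\<in>{..<k}. succeeds_within k adv \<omega> L v} \<in> events"
    by (intro sets.sets_Collect_finite_All) (simp_all add: sets_succeeds_within)
  hence S: "?S \<in> events" by (simp add: Ball_def)
  \<comment> \<open>The inclusion holds only almost surely: a station that is never activated does
    not succeed, yet it does not count as failing in \<open>?F\<close> either.\<close>
  have "AE \<omega> in coin_space b. \<omega> \<in> UNIV - ?S \<longrightarrow> \<omega> \<in> (\<Union>v<k. ?F v)"
    using assms(1) unfolding activates_all_def
  proof eventually_elim
    case (elim \<omega>)
    show ?case
    proof
      assume "\<omega> \<in> UNIV - ?S"
      then obtain v where v: "v < k" "\<not> succeeds_within k adv \<omega> L v" by auto
      obtain s where s: "v \<in> activated_at k adv \<omega> s" using elim v(1) by auto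
      have "fails_before k adv T v \<omega> (Suc (s + T))"
        unfolding fails_before_def
      proof (intro exI[of _ s] conjI ballI notI)
        fix r assume "r \<in> {s<..s + T}" "successful k adv \<omega> v r"
        with s assms(2) have "succeeds_within k adv \<omega> L v"
          unfolding succeeds_within_def by (intro exI[of _ s] exI[of _ r]) auto
        with v(2) show False by simp
      qed (use s in auto)
      with v(1) show "\<omega> \<in> (\<Union>v<k. ?F v)" by auto
    qed
  qed
  hence "prob (UNIV - ?S) \<le> prob (\<Union>v<k. ?F v)"
    by (rule finite_measure_mono_AE) (intro sets.finite_UN F finite_lessThan)
  also have "\<dots> \<le> (\<Sum>v<k. prob (?F v))"
    using F by (intro finite_measure_subadditive_finite) auto
  also have "\<dots> \<le> (\<Sum>v<k. exp (- transmission_prob b T * T / 4))"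
    using prob_fails_le[OF assms(3)] by (intro sum_mono) auto
  finally show ?thesis
    using prob_compl[OF S] by simp
qed

section \<open>Choice of the latency\<close>

text \<open>The difference \<open>harm n - ln n\<close> decreases from its value 1 at
  \<open>n = 1\<close>.\<close>

lemma harm_le_one_plus_ln:
  assumes "n > 0"
  shows "harm n \<le> 1 + ln (real n)"
  using decseqD[OF decseq_harm_diff_ln, of 0 "n - 1"] assms by (simp add: harm_expand)

lemma mult_phase_ge:
  assumes "b > 0"
  shows "i \<le> b * phase b i"
proof -
  have "i - 1 = b * ((i - 1) div b) + (i - 1) mod b" by (rule mult_div_mod_eq[symmetric])
  moreover have "(i - 1) mod b < b" using assms by simp
  moreover have "b * phase b i = 3 * b + b * ((i - 1) div b)"
    by (simp add: phase_def algebra_simps)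
  ultimately show ?thesis using assms by linarith
qed

lemma mult_phase_le: "b * phase b i \<le> 3 * b + i"
proof -
  have "b * phase b i = 3 * b + b * ((i - 1) div b)"
    by (simp add: phase_def algebra_simps)
  thus ?thesis using times_div_less_eq_dividend[of b "i - 1"] by linarith
qed

text \<open>Phase \<open>j\<close> of local round \<open>i\<close> satisfies
  \<open>j \<ge> i / b\<close> and \<open>ln j \<le> 1 + ln T\<close>, so each term is at most
  \<open>b * (1 + ln T) / i\<close>; the harmonic sum supplies the second logarithm.\<close>

lemma sum_transmission_prob_le:
  assumes "b > 0" "T > 0" "3 * b \<le> T"
  shows "(\<Sum>i=1..T. transmission_prob b i) \<le> b * (1 + ln (real T))\<^sup>2"
proof -
  have "phase b T \<le> b * phase b T" using assms(1) by simp
  \<comment> \<open>The factor 2 costs only \<open>ln 2 \<le> 1\<close> in the logarithm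
    below.\<close>
  also have "\<dots> \<le> 2 * T" using mult_phase_le[of b T] assms(3) by linarith
  finally have N: "real (phase b T) \<le> 2 * real T" by linarith
  have "ln (real (phase b T)) \<le> ln (2 * real T)"
    using N phase_ge_3[of b T] by simp
  also have "\<dots> \<le> 1 + ln (real T)"
    using assms(2) ln_le_minus_one[of 2] by (simp add: ln_mult)
  finally have ln_N: "ln (real (phase b T)) \<le> 1 + ln (real T)" .
  have "transmission_prob b i \<le> b * (1 + ln (real T)) * inverse (real i)" if "i \<in> {1..T}" for i
  proof -
    have "phase b i \<le> phase b T"
      using that by (auto simp: phase_def intro!: div_le_mono)
    hence "ln (real (phase b i)) \<le> 1 + ln (real T)"
      using ln_N phase_ge_3[of b i] by (auto intro: order_trans[rotated])
    moreover have "real i \<le> real b * real (phase b i)"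
      using mult_phase_ge[OF assms(1), of i] by (metis of_nat_le_iff of_nat_mult)
    ultimately have "ln (real (phase b i)) * real i \<le> (1 + ln (real T)) * (real b * real (phase b i))"
      using phase_ge_3[of b i] by (intro mult_mono) (auto intro: order_trans[of 0 "ln (real (phase b i))"])
    thus ?thesis
      using that phase_ge_3[of b i] by (simp add: transmission_prob_def field_simps)
  qed
  hence "(\<Sum>i=1..T. transmission_prob b i) \<le> (\<Sum>i=1..T. b * (1 + ln (real T)) * inverse (real i))"
    by (rule sum_mono)
  also have "\<dots> = b * (1 + ln (real T)) * harm T"
    by (simp add: harm_def sum_distrib_left)
  also have "\<dots> \<le> b * (1 + ln (real T)) * (1 + ln (real T))"
    using harm_le_one_plus_ln[OF assms(2)] assms(2) by (intro mult_left_mono) auto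
  finally show ?thesis by (simp add: power2_eq_square mult.assoc)
qed

text \<open>The second condition will give a latency of at least \<open>6 * b * k\<close>. The third
  absorbs the contribution of \<open>C\<close> itself to \<open>ln T\<close>, which is possible
  because \<open>(ln C)\<^sup>2\<close> is of smaller order than \<open>C\<close>.\<close>

lemma latency_constant_exists:
  "\<exists>C::real. C \<ge> 1 \<and> C \<ge> 6 * B / (ln 2)\<^sup>2 \<and> C \<ge> 8 * B * ((1 + ln C) / ln 2 + 3)\<^sup>2"
proof -
  have "(\<lambda>C::real. B * ((1 + ln C) / ln 2 + 3)\<^sup>2) \<in> o(\<lambda>C::real. C)"
    by real_asymp
  hence "eventually (\<lambda>C. \<bar>B * ((1 + ln C) / ln 2 + 3)\<^sup>2\<bar> \<le> 1 / 8 * \<bar>C\<bar>) at_top"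
    using landau_o.smallD[of _ _ _ "1 / 8 :: real"] by fastforce
  hence "eventually (\<lambda>C. C \<ge> 1 \<and> C \<ge> 6 * B / (ln 2)\<^sup>2 \<and> C \<ge> 8 * B * ((1 + ln C) / ln 2 + 3)\<^sup>2) at_top"
    using eventually_ge_at_top[of 1] eventually_ge_at_top[of "6 * B / (ln 2)\<^sup>2"]
    by eventually_elim (auto simp: mult.assoc)
  thus ?thesis
    using eventually_happens trivial_limit_at_top_linorder by blast
qed

text \<open>The second bound serves \<open>sum_transmission_prob_le\<close>, the third places local
  round \<open>T\<close> in phase \<open>k\<close> or later, and the fourth yields the hypothesis of
  \<open>card_low_load_ge\<close>.\<close>

lemma latency_bounds:
  fixes C :: real
  assumes b: "b > 0" and k: "k \<ge> 2"
    and C: "C \<ge> 1" "C \<ge> 6 * real b / (ln 2)\<^sup>2" "C \<ge> 8 * real b * ((1 + ln C) / ln 2 + 3)\<^sup>2"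
  defines "T \<equiv> nat \<lfloor>C * real k * (ln (real k))\<^sup>2\<rfloor>"
  shows "real T \<le> C * real k * (ln (real k))\<^sup>2" (is ?A)
    and "3 * b \<le> T" (is ?B)
    and "b * k \<le> T" (is ?C)
    and "4 * real k * (b * (1 + ln (real T))\<^sup>2) \<le> T" (is ?D)
proof -
  define x where "x = ln (real k)"
  have x: "ln 2 \<le> x" "0 < x" using k by (auto simp: x_def)
  have "6 * real b \<le> C * (ln 2)\<^sup>2" using C(2) by (simp add: field_simps)
  also have "\<dots> \<le> C * x\<^sup>2" using x C(1) by (intro mult_left_mono power_mono) auto
  finally have Cx: "6 * real b \<le> C * x\<^sup>2" .
  have "6 * real b * real k \<le> C * x\<^sup>2 * real k" by (rule mult_right_mono[OF Cx]) simp
  hence Ckx: "6 * real b * real k \<le> C * k * x\<^sup>2" by (simp add: mult_ac)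
  have bk: "real b \<ge> 1" "real b * real k \<ge> 2" "real b * real k \<ge> 2 * real b"
    using b k mult_mono[of 1 "real b" 2 "real k"] mult_left_mono[of 2 "real k" "real b"] by auto
  have T_le: "T \<le> C * k * x\<^sup>2" unfolding T_def x_def using C(1) by simp
  thus ?A by (simp add: x_def)
  have "T \<ge> C * k * x\<^sup>2 - 1" unfolding T_def x_def by linarith
  \<comment> \<open>Rounding down loses at most 1, which is at most half of a quantity that is at
    least 2.\<close>
  hence T_ge: "T \<ge> C * k * x\<^sup>2 / 2" using Ckx bk by argo
  hence T3: "3 * (real b * real k) \<le> T" using Ckx by simp
  show ?B using T3 bk(3) by (simp flip: of_nat_le_iff)
  have "real (b * k) \<le> T" using T3 bk(2) by simp
  thus ?C by (simp only: of_nat_le_iff)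
  have T_pos: "real T > 0" using T3 bk by linarith
  hence ln_T_nonneg: "ln (real T) \<ge> 0" by simp
  have "ln (real T) \<le> ln (C * k * x\<^sup>2)" using T_le T_pos by simp
  also have "\<dots> = ln C + x + 2 * ln x"
    using C(1) k x by (simp add: ln_mult ln_realpow x_def)
  also have "ln x \<le> x"
    using ln_le_minus_one[OF x(2)] by simp
  finally have "1 + ln (real T) \<le> (1 + ln C) * 1 + 3 * x" by simp
  \<comment> \<open>As \<open>x \<ge> ln 2\<close>, the constant term becomes a multiple of
    \<open>x\<close>, uniformly in \<open>k \<ge> 2\<close>.\<close>
  also have "\<dots> \<le> (1 + ln C) * (x / ln 2) + 3 * x"
    using C(1) x by (intro add_right_mono mult_left_mono) auto
  also have "\<dots> = x * ((1 + ln C) / ln 2 + 3)" by (simp add: field_simps)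
  finally have "(1 + ln (real T))\<^sup>2 \<le> (x * ((1 + ln C) / ln 2 + 3))\<^sup>2"
    using ln_T_nonneg by (intro power_mono) auto
  hence "4 * real k * (b * (1 + ln (real T))\<^sup>2) \<le> 4 * real k * (b * (x * ((1 + ln C) / ln 2 + 3))\<^sup>2)"
    by (intro mult_left_mono) auto
  also have "\<dots> = (8 * real b * ((1 + ln C) / ln 2 + 3)\<^sup>2) * (k * x\<^sup>2 / 2)"
    by (simp add: power_mult_distrib)
  also have "\<dots> \<le> C * (k * x\<^sup>2 / 2)"
    using C(3) by (rule mult_right_mono) simp
  also have "\<dots> \<le> T" using T_ge by simp
  finally show ?D .
qed

theorem theorem5p1:
  "\<forall>\<eta>::real. \<eta> > 0 \<longrightarrow>
     (\<exists>b\<^sub>0::nat. \<forall>b\<ge>b\<^sub>0. \<exists>C::real. \<forall>k::nat. k \<ge> 2 \<longrightarrow>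
       (\<forall>adv::adversary. activates_all b k adv \<longrightarrow>
          \<P>(\<omega> in coin_space b. \<forall>v<k. succeeds_within k adv \<omega> (C * real k * (ln (real k))\<^sup>2) v)
            \<ge> 1 - 1 / real k powr \<eta>))"
proof (intro allI impI)
  fix \<eta> :: real assume \<eta>: "\<eta> > 0"
  show "\<exists>b\<^sub>0::nat. \<forall>b\<ge>b\<^sub>0. \<exists>C::real. \<forall>k::nat. k \<ge> 2 \<longrightarrow>
       (\<forall>adv::adversary. activates_all b k adv \<longrightarrow>
          \<P>(\<omega> in coin_space b. \<forall>v<k. succeeds_within k adv \<omega> (C * real k * (ln (real k))\<^sup>2) v)
            \<ge> 1 - 1 / real k powr \<eta>)"
  \<comment> \<open>Each station fails with probability at most \<open>k powr (- b / 8)\<close>; the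
    exponent must cover \<open>\<eta>\<close> and one more factor \<open>k\<close> from the union
    bound.\<close>
  proof (intro exI[of _ "nat \<lceil>8 * (\<eta> + 1)\<rceil>"] allI impI)
    fix b assume "nat \<lceil>8 * (\<eta> + 1)\<rceil> \<le> b"
    hence b: "8 * (\<eta> + 1) \<le> b" by linarith
    hence b_pos: "b > 0" using \<eta> by (cases "b = 0") auto
    obtain C where C: "C \<ge> 1" "C \<ge> 6 * real b / (ln 2)\<^sup>2" "C \<ge> 8 * real b * ((1 + ln C) / ln 2 + 3)\<^sup>2"
      using latency_constant_exists by blast
    show "\<exists>C::real. \<forall>k::nat. k \<ge> 2 \<longrightarrow> (\<forall>adv::adversary. activates_all b k adv \<longrightarrow>
          \<P>(\<omega> in coin_space b. \<forall>v<k. succeeds_within k adv \<omega> (C * real k * (ln (real k))\<^sup>2) v)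
            \<ge> 1 - 1 / real k powr \<eta>)"
    proof (intro exI[of _ C] allI impI)
      fix k :: nat and adv :: adversary
      assume k: "k \<ge> 2" and adv: "activates_all b k adv"
      define L where "L = C * real k * (ln (real k))\<^sup>2"
      define T where "T = nat \<lfloor>L\<rfloor>"
      note T = latency_bounds[OF b_pos k C, folded L_def, folded T_def]
      define N where "N = phase b T"
      have "b * k \<le> b * N"
        using T(3) mult_phase_ge[OF b_pos, of T] unfolding N_def by linarith
      hence N: "N \<ge> k" using b_pos by simp
      have "b * N \<le> 2 * T" using mult_phase_le[of b T] T(2) unfolding N_def by linarith
      hence bN: "real b * real N \<le> 2 * real T" by (metis of_nat_le_iff of_nat_mult of_nat_numeral)
      have "(\<eta> + 1) * ln k \<le> b / 8 * ln N"
        using b \<eta> N k by (intro mult_mono) auto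
      \<comment> \<open>The transmission probability is \<open>ln N / N\<close>, and
        \<open>T / N \<ge> b / 2\<close> by \<open>bN\<close>.\<close>
      also have "\<dots> \<le> transmission_prob b T * T / 4"
        using mult_left_mono[OF bN, of "ln (real N)"] N k
        by (simp add: transmission_prob_def N_def[symmetric] field_simps)
      finally have "exp (- transmission_prob b T * T / 4) \<le> exp (- (\<eta> + 1) * ln k)"
        by (simp add: algebra_simps)
      hence "k * exp (- transmission_prob b T * T / 4) \<le> k * exp (- (\<eta> + 1) * ln k)"
        by (intro mult_left_mono) auto
      also have "\<dots> = k powr 1 * k powr (- (\<eta> + 1))"
        using k by (simp add: powr_def)
      also have "\<dots> = k powr (1 + - (\<eta> + 1))"
        by (rule powr_add[symmetric])
      also have "\<dots> = 1 / k powr \<eta>"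
        by (simp add: powr_minus_divide)
      finally have le: "k * exp (- transmission_prob b T * T / 4) \<le> 1 / k powr \<eta>" .
      have "4 * real k * (\<Sum>i=1..T. transmission_prob b i) \<le> 4 * real k * (b * (1 + ln (real T))\<^sup>2)"
        using sum_transmission_prob_le[OF b_pos _ T(2)] T(2) b_pos by (intro mult_left_mono) auto
      also note T(4)
      finally have "1 - k * exp (- transmission_prob b T * T / 4)
          \<le> measure (coin_space b) {\<omega>. \<forall>v<k. succeeds_within k adv \<omega> L v}"
        using adv T(1) by (intro prob_all_succeed_ge)
      with le show "\<P>(\<omega> in coin_space b. \<forall>v<k. succeeds_within k adv \<omega> (C * real k * (ln (real k))\<^sup>2) v)
            \<ge> 1 - 1 / real k powr \<eta>"
        by (simp add: L_def)
    qed
  qed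
qed

end
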